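(* Let $g:\mathbb{C}\to\mathbb{C}$ be a polynomial of degree $d\ge 2$ and let $h:\mathbb{C}\to\mathbb{C}$ be $L$-bi-Lipschitz. Let $f=g\circ h$. Then $I(f)$ is a non-empty open set and $\partial I(f)$ is a perfect set.
   Context: A map $h:\mathbb{C}\to\mathbb{C}$ is $L$-bi-Lipschitz (with $L\ge1$) if $\frac{|z-w|}{L}\le|h(z)-h(w)|\le L|z-w|$ for all $z,w\in\mathbb{C}$. The escaping set of $f:\mathbb{C}\to\mathbb{C}$ is $I(f)=\{z\in\mathbb{C}: f^{n}(z)\to\infty \text{ as } n\to\infty\}$, where $f^n$ is the $n$-th iterate, and $\partial I(f)$ is its topological boundary in $\mathbb{C}$. A set is perfect if it is closed and has no isolated points. *)

theory Defs
  imports "HOL-Analysis.Analysis" "HOL-Computational_Algebra.Polynomial"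
begin

definition bi_lipschitz :: "real \<Rightarrow> (complex \<Rightarrow> complex) \<Rightarrow> bool" where
  "bi_lipschitz L h \<longleftrightarrow>
     L \<ge> 1 \<and> (\<forall>z w. cmod (z - w) / L \<le> cmod (h z - h w) \<and> cmod (h z - h w) \<le> L * cmod (z - w))"

definition escaping_set :: "(complex \<Rightarrow> complex) \<Rightarrow> complex set" where
  "escaping_set f = {z. filterlim (\<lambda>n. (f ^^ n) z) at_infinity sequentially}"

text \<open>The empty set counts as perfect.\<close>

definition perfect_set :: "'a::topological_space set \<Rightarrow> bool" where
  "perfect_set S \<longleftrightarrow> closed S \<and> \<not> (\<exists>x. x isolated_in S)"

end

theory Submission
  imports Defs "HOL-Complex_Analysis.Complex_Analysis"
    "HOL-Computational_Algebra.Fundamental_Theorem_Algebra"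
begin

text \<open>
  Since \<open>g\<close> has degree at least two and \<open>h\<close> distorts distances by a bounded factor, \<open>f\<close> at least
  doubles the modulus of every sufficiently large number. Hence a point escapes as soon as its
  orbit leaves some fixed disc, which makes the escaping set \<open>I\<close> non-empty and open.

  A frontier is closed, so the issue is to exclude an isolated point \<open>x\<close> of the frontier of \<open>I\<close>. As
  a punctured disc is connected, a small punctured disc around \<open>x\<close> would lie in \<open>I\<close>, while \<open>x\<close>
  itself does not (\<open>isolated_frontier_punctured_ball\<close>). The boundary circle of this disc is a
  compact subset of \<open>I\<close>, so some iterate \<open>f\<^sup>N\<close> throws it out of the fixed large disc. But \<open>f\<close> is an
  open map: \<open>g\<close> is one by the open mapping theorem, and \<open>h\<close> is a homeomorphism of the plane by
  invariance of domain. So \<open>f\<^sup>N\<close> maps the small disc onto a set covering the whole large disc, and in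
  particular all non-escaping points. As \<open>I\<close> is completely invariant, \<open>x\<close> is then the only
  non-escaping point (\<open>isolated_nonescaping_unique\<close>).

  It follows that \<open>x\<close> is its own only preimage, so \<open>h x\<close> is the only root of \<open>g - x\<close>, and it is a
  multiple root because the degree is at least two. Together with the upper Lipschitz bound this
  gives \<open>\<bar>f z - x\<bar> \<le> C \<bar>z - x\<bar>\<^sup>2\<close> near \<open>x\<close>. So small discs around \<open>x\<close> are mapped into themselves and
  contain no escaping points, a contradiction.
\<close>

section \<open>Escape under expansion near infinity\<close>

lemma funpow_in_escaping_set_iff:
  "(f ^^ n) z \<in> escaping_set f \<longleftrightarrow> z \<in> escaping_set f"
proof -
  have "(\<lambda>m. (f ^^ m) ((f ^^ n) z)) = (\<lambda>m. (f ^^ (m + n)) z)"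
    by (simp add: funpow_add)
  then show ?thesis
    using eventually_sequentially_seg[of "\<lambda>m. P ((f ^^ m) z)" n for P]
    unfolding escaping_set_def mem_Collect_eq filterlim_iff by (simp add: fun_eq_iff)
qed

lemma not_escaping_if_bounded_orbit:
  assumes "\<And>n. (f ^^ n) z \<in> B" "bounded B"
  shows "z \<notin> escaping_set f"
proof
  assume "z \<in> escaping_set f"
  then have lim: "filterlim (\<lambda>n. cmod ((f ^^ n) z)) at_top sequentially"
    by (simp add: escaping_set_def filterlim_at_infinity_conv_norm_at_top)
  obtain b where "\<And>w. w \<in> B \<Longrightarrow> cmod w \<le> b"
    using assms(2) by (auto simp: bounded_iff)
  then have "\<And>n. cmod ((f ^^ n) z) \<le> b" using assms(1) by blast
  moreover obtain n where "cmod ((f ^^ n) z) > b"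
    using lim unfolding filterlim_at_top_dense
    by (meson eventually_happens trivial_limit_sequentially)
  ultimately show False by (meson not_le)
qed

lemma funpow_expanding:
  fixes f :: "complex \<Rightarrow> complex"
  assumes "R > 0" and grow: "\<And>z. cmod z > R \<Longrightarrow> cmod (f z) \<ge> 2 * cmod z"
    and "cmod z > R"
  shows "cmod ((f ^^ n) z) \<ge> 2 ^ n * cmod z"
proof (induction n)
  case (Suc n)
  have "1 * cmod z \<le> 2 ^ n * cmod z"
    by (intro mult_right_mono) auto
  then have "cmod ((f ^^ n) z) > R" using Suc assms(3) by linarith
  from grow[OF this] show ?case using Suc by simp
qed simp

lemma escaping_set_eq_leave_disc:
  assumes "R > 0" and grow: "\<And>z. cmod z > R \<Longrightarrow> cmod (f z) \<ge> 2 * cmod z"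
  shows "escaping_set f = (\<Union>n. {z. cmod ((f ^^ n) z) > R})"
proof (intro set_eqI iffI)
  fix z assume "z \<in> escaping_set f"
  then have "\<not> (\<forall>n. (f ^^ n) z \<in> cball 0 R)"
    using not_escaping_if_bounded_orbit[OF _ bounded_cball] by metis
  then show "z \<in> (\<Union>n. {z. cmod ((f ^^ n) z) > R})" by (auto simp: not_le)
next
  fix z assume "z \<in> (\<Union>n. {z. cmod ((f ^^ n) z) > R})"
  then obtain k where k: "cmod ((f ^^ k) z) > R" by blast
  define w where "w = (f ^^ k) z"
  have "filterlim (\<lambda>n. 2 ^ n :: real) at_top sequentially"
    using filterlim_realpow_sequentially_gt1[of "2 :: real"]
    by (simp add: filterlim_at_infinity_conv_norm_at_top norm_power)
  moreover have "cmod w > 0" using k assms(1) unfolding w_def by linarith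
  ultimately have "filterlim (\<lambda>n. 2 ^ n * cmod w) at_top sequentially"
    by (intro filterlim_at_top_mult_tendsto_pos[OF tendsto_const])
  then have "filterlim (\<lambda>n. cmod ((f ^^ n) w)) at_top sequentially"
    by (rule filterlim_at_top_mono)
      (use funpow_expanding[OF assms k] in \<open>auto simp: w_def\<close>)
  then have "w \<in> escaping_set f"
    unfolding escaping_set_def by (simp add: filterlim_at_infinity_conv_norm_at_top)
  then show "z \<in> escaping_set f" by (simp add: w_def funpow_in_escaping_set_iff)
qed

lemma continuous_on_funpow:
  fixes f :: "'a::topological_space \<Rightarrow> 'a"
  assumes "continuous_on UNIV f"
  shows "continuous_on UNIV (f ^^ n)"
proof (induction n)
  case (Suc n)
  then show ?case
    using assms unfolding funpow.simps(2) by (meson continuous_on_compose continuous_on_subset subset_UNIV)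
qed (auto simp: id_def)

lemma open_image_funpow:
  fixes f :: "'a::topological_space \<Rightarrow> 'a"
  assumes "\<And>U. open U \<Longrightarrow> open (f ` U)" and "open U"
  shows "open ((f ^^ n) ` U)"
proof (induction n)
  case (Suc n)
  then show ?case using assms(1)[of "(f ^^ n) ` U"] by (simp add: image_comp)
qed (use assms in auto)

lemma open_leave_disc:
  fixes f :: "complex \<Rightarrow> complex"
  assumes "continuous_on UNIV f"
  shows "open {z. cmod ((f ^^ n) z) > R}"
  by (intro open_Collect_less continuous_intros continuous_on_funpow assms)

text \<open>The sets of points that have left the disc by time \<open>n\<close> increase with \<open>n\<close> and form an open cover of
  the escaping set.\<close>

lemma compact_escapes_uniformly:
  assumes "R > 0" and grow: "\<And>z. cmod z > R \<Longrightarrow> cmod (f z) \<ge> 2 * cmod z"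
    and cont: "continuous_on UNIV f"
    and "compact C" "C \<subseteq> escaping_set f"
  obtains N where "\<And>z. z \<in> C \<Longrightarrow> cmod ((f ^^ N) z) > R"
proof -
  let ?V = "\<lambda>n. {z. cmod ((f ^^ n) z) > R}"
  have mono: "?V m \<subseteq> ?V n" if "m \<le> n" for m n
  proof
    fix z assume "z \<in> ?V m"
    then have z: "cmod ((f ^^ m) z) > R" by simp
    have "(f ^^ n) z = (f ^^ (n - m)) ((f ^^ m) z)"
      using that by (metis comp_apply funpow_add le_add_diff_inverse2)
    moreover have "1 * cmod ((f ^^ m) z) \<le> 2 ^ (n - m) * cmod ((f ^^ m) z)"
      by (intro mult_right_mono) auto
    ultimately have "cmod ((f ^^ n) z) \<ge> cmod ((f ^^ m) z)"
      using funpow_expanding[OF assms(1,2) z, of "n - m"] by simp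
    with z show "z \<in> ?V n" by simp
  qed
  have "C \<subseteq> (\<Union>n\<in>UNIV. ?V n)"
    using assms(5) escaping_set_eq_leave_disc[OF assms(1,2)] by simp
  then obtain A where A: "finite A" "C \<subseteq> (\<Union>n\<in>A. ?V n)"
    by (rule compactE_image[OF \<open>compact C\<close> open_leave_disc[OF cont]]) auto
  have "C \<subseteq> ?V (Max (insert 0 A))"
  proof
    fix z assume "z \<in> C"
    then obtain n where "n \<in> A" "z \<in> ?V n" using A by blast
    then show "z \<in> ?V (Max (insert 0 A))"
      using mono[of n "Max (insert 0 A)"] A(1) by auto
  qed
  then show ?thesis by (intro that[of "Max (insert 0 A)"]) auto
qed

section \<open>Isolated points of the frontier\<close>

lemma isolated_frontier_punctured_ball:
  fixes I :: "complex set"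
  assumes "open I" "x isolated_in frontier I"
  obtains r where "r > 0" "x \<notin> I" "ball x r - {x} \<subseteq> I"
proof -
  from assms(2) obtain T where "x \<in> frontier I" and T: "open T" "T \<inter> frontier I = {x}"
    unfolding isolated_in_def by blast
  then have "x \<notin> I" using assms(1) by (simp add: frontier_def interior_open)
  obtain r where r: "r > 0" "ball x r \<subseteq> T"
    using openE[OF T(1)] T(2) by blast
  have conn: "connected (ball x r - {x})"
    by (rule connected_punctured_ball) simp
  have disj: "(ball x r - {x}) \<inter> frontier I = {}" using r T by blast
  have meet: "(ball x r - {x}) \<inter> I \<noteq> {}"
  proof -
    have "x \<in> closure I" using \<open>x \<in> frontier I\<close> by (simp add: frontier_def)
    then obtain y where y: "y \<in> I" "dist y x < r"
      using r(1) unfolding closure_approachable by blast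
    moreover have "y \<noteq> x" using y(1) \<open>x \<notin> I\<close> by blast
    ultimately have "y \<in> (ball x r - {x}) \<inter> I" by (simp add: dist_commute)
    then show ?thesis by blast
  qed
  have "ball x r - {x} - I = {}"
    by (rule ccontr) (rule notE[OF connected_Int_frontier[OF conn meet] disj])
  then have "ball x r - {x} \<subseteq> I" by (simp only: Diff_eq_empty_iff)
  then show ?thesis by (rule that[OF r(1) \<open>x \<notin> I\<close>])
qed

text \<open>Once the boundary of a disc around \<open>x\<close> has been thrown out of the disc of radius \<open>R\<close>, the frontier
  of the (open) image of the disc misses the connected set \<open>cball 0 R\<close>. The image meets this set
  because the orbit of \<open>x\<close> stays in it, and so covers it.\<close>

lemma isolated_nonescaping_unique:
  assumes "R > 0" and grow: "\<And>z. cmod z > R \<Longrightarrow> cmod (f z) \<ge> 2 * cmod z"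
    and cont: "continuous_on UNIV f"
    and opn: "\<And>U. open U \<Longrightarrow> open (f ` U)"
    and "r > 0" "x \<notin> escaping_set f" "ball x r - {x} \<subseteq> escaping_set f"
  shows "- escaping_set f = {x}"
proof -
  have leave: "z \<in> escaping_set f" if "cmod ((f ^^ n) z) > R" for z n
    using that escaping_set_eq_leave_disc[OF assms(1,2)] by blast
  define s where "s = r / 2"
  have s: "s > 0" "cball x s \<subseteq> ball x r" using \<open>r > 0\<close> by (auto simp: s_def)
  have "sphere x s \<subseteq> escaping_set f"
    using s assms(7) by (force simp: subset_eq)
  then obtain N where N: "\<And>z. z \<in> sphere x s \<Longrightarrow> cmod ((f ^^ N) z) > R"
    using compact_escapes_uniformly[OF assms(1,2) cont compact_sphere] by blast
  let ?F = "f ^^ N"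
  have "compact (?F ` cball x s)"
    by (meson compact_cball compact_continuous_image continuous_on_funpow continuous_on_subset
        cont subset_UNIV)
  then have "closure (?F ` ball x s) \<subseteq> ?F ` cball x s"
    by (intro closure_minimal image_mono compact_imp_closed) auto
  moreover have "open (?F ` ball x s)" by (intro open_image_funpow opn) auto
  ultimately have "frontier (?F ` ball x s) \<subseteq> ?F ` sphere x s"
    by (fastforce simp: frontier_def interior_open)
  then have "cball 0 R \<inter> frontier (?F ` ball x s) = {}"
    using N by fastforce
  moreover have "?F x \<in> cball 0 R \<inter> ?F ` ball x s"
    using leave[of N x] assms(6) s by force
  ultimately have cover: "cball 0 R \<subseteq> ?F ` ball x s"
    using connected_Int_frontier[of "cball 0 R" "?F ` ball x s"] convex_connected[OF convex_cball]
    unfolding Diff_eq_empty_iff[symmetric] by (metis empty_iff)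
  have "y = ?F x" if "y \<notin> escaping_set f" for y
  proof -
    have "y \<in> cball 0 R" using leave[of 0 y] that by force
    then obtain w where w: "w \<in> ball x s" "y = ?F w" using cover by blast
    then have "w \<notin> escaping_set f" using that by (simp add: funpow_in_escaping_set_iff)
    then have "w = x" using w(1) assms(7) s(2) ball_subset_cball by blast
    with w show ?thesis by simp
  qed
  then have "y \<notin> escaping_set f \<longleftrightarrow> y = x" for y using assms(6) by metis
  then show ?thesis by blast
qed

section \<open>Bi-Lipschitz maps of the plane\<close>

lemma bi_lipschitz_continuous:
  assumes "bi_lipschitz L h"
  shows "continuous_on UNIV h"
proof -
  have "L-lipschitz_on UNIV h"
    using assms by (intro lipschitz_onI) (auto simp: bi_lipschitz_def dist_norm)
  then show ?thesis by (rule lipschitz_on_continuous_on)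
qed

lemma bi_lipschitz_inj:
  assumes "bi_lipschitz L h"
  shows "inj h"
proof (rule injI)
  fix z w assume "h z = h w"
  then have "cmod (z - w) / L \<le> 0" "L \<ge> 1"
    using assms unfolding bi_lipschitz_def by (metis cancel_comm_monoid_add_class.diff_cancel norm_zero, blast)
  then show "z = w" by (simp add: divide_le_0_iff)
qed

lemma bi_lipschitz_open_image:
  assumes "bi_lipschitz L h" "open U"
  shows "open (h ` U)"
proof (rule invariance_of_domain)
  show "continuous_on U h"
    using bi_lipschitz_continuous[OF assms(1)] continuous_on_subset by blast
  show "inj_on h U" using bi_lipschitz_inj[OF assms(1)] inj_on_subset by blast
qed (rule assms(2))

text \<open>The range is open by invariance of domain, and complete by the lower Lipschitz bound.\<close>

lemma bi_lipschitz_surj: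
  assumes "bi_lipschitz L h"
  shows "surj h"
proof -
  have L: "L \<ge> 1" "\<And>z w. cmod (z - w) \<le> L * cmod (h z - h w)"
    using assms by (auto simp: bi_lipschitz_def field_simps)
  have "closed (range h)"
    unfolding closed_sequential_limits
  proof (intro allI impI, elim conjE)
    fix u l assume u: "\<forall>n. u n \<in> range h" "u \<longlonglongrightarrow> l"
    then have "\<forall>n. \<exists>w. u n = h w" by blast
    then obtain v where v: "\<And>n. u n = h (v n)" unfolding choice_iff by blast
    have "Cauchy v"
    proof (rule metric_CauchyI)
      fix e :: real assume "e > 0"
      have "Cauchy u" using u(2) by (rule LIMSEQ_imp_Cauchy)
      then obtain M where M: "\<And>m n. m \<ge> M \<Longrightarrow> n \<ge> M \<Longrightarrow> dist (u m) (u n) < e / L"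
        using metric_CauchyD[of u "e / L"] \<open>e > 0\<close> L(1) by auto
      have "dist (v m) (v n) < e" if "m \<ge> M" "n \<ge> M" for m n
        using M[OF that] L(1) L(2)[of "v m" "v n"] by (simp add: v dist_norm field_simps)
      then show "\<exists>M. \<forall>m\<ge>M. \<forall>n\<ge>M. dist (v m) (v n) < e" by blast
    qed
    then obtain y where "v \<longlonglongrightarrow> y" using Cauchy_convergent convergent_def by metis
    then have "(\<lambda>n. h (v n)) \<longlonglongrightarrow> h y"
      using bi_lipschitz_continuous[OF assms] by (auto intro: continuous_on_tendsto_compose)
    moreover have "(\<lambda>n. h (v n)) = u" using v by (simp add: fun_eq_iff)
    ultimately have "l = h y" using u(2) LIMSEQ_unique by blast
    then show "l \<in> range h" by simp
  qed
  moreover have "open (range h)" by (rule bi_lipschitz_open_image[OF assms open_UNIV])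
  ultimately show ?thesis using clopen[of "range h"] by auto
qed

section \<open>Polynomials composed with bi-Lipschitz maps\<close>

lemma poly_open_image:
  fixes p :: "complex poly"
  assumes "degree p > 0" "open U"
  shows "open (poly p ` U)"
proof (rule open_mapping_thm2[of "poly p" UNIV])
  fix X :: "complex set" assume X: "open X" "X \<noteq> {}"
  show "\<not> poly p constant_on X"
  proof
    assume "poly p constant_on X"
    then obtain c where "\<forall>z\<in>X. poly p z = c" by (auto simp: constant_on_def)
    then have "X \<subseteq> {z. poly (p - [:c:]) z = 0}" by auto
    moreover have "p - [:c:] \<noteq> 0" using assms(1) by auto
    ultimately have "finite X" using poly_roots_finite finite_subset by blast
    then show False using X by (meson finite_imp_not_open)
  qed
qed (use assms in \<open>auto intro: holomorphic_intros\<close>)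

text \<open>Write \<open>p = a + X q\<close>. As \<open>q\<close> is not constant, \<open>\<bar>q w\<bar>\<close> exceeds any bound for large \<open>w\<close>, and so
  the factor \<open>q\<close> outweighs the contraction by \<open>h\<close>.\<close>

lemma poly_bi_lipschitz_expanding:
  fixes p :: "complex poly"
  assumes "degree p \<ge> 2" "bi_lipschitz L h"
  obtains R where "R > 0" "\<And>z. cmod z > R \<Longrightarrow> cmod (poly p (h z)) \<ge> 2 * cmod z"
proof -
  have L: "L \<ge> 1" "\<And>z w. cmod (z - w) \<le> L * cmod (h z - h w)"
    using assms(2) by (auto simp: bi_lipschitz_def field_simps)
  obtain a b s where p: "p = pCons a (pCons b s)" by (metis pCons_cases)
  have "s \<noteq> 0" using assms(1) by (auto simp: p split: if_splits)
  \<comment> \<open>Far out, \<open>\<bar>h z\<bar> \<ge> \<bar>z\<bar> / (2 L)\<close>, so the bound \<open>6 L\<close> gives \<open>\<bar>p (h z)\<bar> \<ge> 3 \<bar>z\<bar> - \<bar>a\<bar>\<close>; the spare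
    \<open>\<bar>z\<bar>\<close> pays for \<open>\<bar>a\<bar>\<close>.\<close>
  then obtain r where r: "\<And>w. r \<le> cmod w \<Longrightarrow> 6 * L \<le> cmod (poly (pCons b s) w)"
    using poly_infinity[of s "6 * L" b] by blast
  define R where "R = 1 + 2 * L * cmod (h 0) + cmod a + 2 * L * \<bar>r\<bar>"
  have nn: "0 \<le> 2 * L * cmod (h 0)" "0 \<le> 2 * L * \<bar>r\<bar>" using L(1) by auto
  show ?thesis
  proof (rule that)
    show "R > 0" using nn by (simp add: R_def add_pos_nonneg)
    fix z assume z: "cmod z > R"
    have "cmod z \<le> L * cmod (h z - h 0)" using L(2)[of z 0] by simp
    also have "\<dots> \<le> L * (cmod (h z) + cmod (h 0))"
      using L(1) by (intro mult_left_mono norm_triangle_ineq4) auto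
    also have "\<dots> = L * cmod (h z) + L * cmod (h 0)" by (rule distrib_left)
    finally have hz: "cmod z \<le> 2 * L * cmod (h z)"
      using z nn norm_ge_zero[of a] unfolding R_def by linarith
    then have "2 * L * \<bar>r\<bar> \<le> 2 * L * cmod (h z)"
      using z nn norm_ge_zero[of a] unfolding R_def by linarith
    then have "r \<le> cmod (h z)" using L(1) by simp
    from r[OF this] have "6 * L * cmod (h z) \<le> cmod (poly (pCons b s) (h z)) * cmod (h z)"
      by (intro mult_right_mono) auto
    also have "\<dots> = cmod (h z * poly (pCons b s) (h z))" by (simp only: norm_mult mult.commute)
    also have "\<dots> \<le> cmod (poly p (h z)) + cmod a"
      using norm_triangle_ineq4[of "poly p (h z)" a] by (simp add: p)
    finally show "cmod (poly p (h z)) \<ge> 2 * cmod z"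
      using hz z nn unfolding R_def by linarith
  qed
qed

text \<open>After one factor \<open>X - c\<close> has been split off, the cofactor is not constant. By the fundamental
  theorem of algebra it has a root, which can only be \<open>c\<close> again.\<close>

lemma single_root_dvd_square:
  fixes q :: "complex poly"
  assumes "degree q \<ge> 2" "\<And>w. poly q w = 0 \<longleftrightarrow> w = c"
  obtains s where "q = [:-c, 1:]\<^sup>2 * s"
proof -
  obtain r where r: "q = [:-c, 1:] * r"
    using assms(2) by (metis dvdE poly_eq_0_iff_dvd)
  then have "r \<noteq> 0" using assms(1) by auto
  then have "degree r \<ge> 1" using r assms(1) by (simp add: degree_mult_eq del: mult_pCons_left)
  then have "\<not> constant (poly r)" by (simp add: constant_degree)
  then obtain w where "poly r w = 0" using fundamental_theorem_of_algebra by blast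
  moreover from this have "w = c" using assms(2)[of w] r by simp
  ultimately obtain s where "r = [:-c, 1:] * s" by (metis dvdE poly_eq_0_iff_dvd)
  then have "q = [:-c, 1:]\<^sup>2 * s" unfolding r power2_eq_square by (simp only: mult.assoc)
  then show ?thesis by (rule that)
qed

text \<open>By \<open>single_root_dvd_square\<close> the distance to \<open>x\<close> is roughly squared near \<open>x\<close>. This bars \<open>x\<close> from being
  repelling, however large the Lipschitz constant is.\<close>

lemma totally_invariant_point_stable:
  fixes p :: "complex poly"
  assumes "degree p \<ge> 2" "bi_lipschitz L h"
    and inv: "\<And>z. poly p (h z) = x \<longleftrightarrow> z = x"
  obtains e where "e > 0" "\<And>z. z \<in> ball x e \<Longrightarrow> poly p (h z) \<in> ball x e"
proof -
  have L: "L \<ge> 1" "\<And>z w. cmod (h z - h w) \<le> L * cmod (z - w)"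
    using assms(2) by (auto simp: bi_lipschitz_def)
  have "poly (p - [:x:]) w = 0 \<longleftrightarrow> w = h x" for w
  proof -
    obtain z where "w = h z" using bi_lipschitz_surj[OF assms(2)] by (metis surjD)
    then show ?thesis
      using inv[of z] bi_lipschitz_inj[OF assms(2)] by (auto simp: inj_eq)
  qed
  moreover have "degree (p - [:x:]) \<ge> 2"
    using assms(1) by (simp add: diff_conv_add_uminus degree_add_eq_left del: add_uminus_conv_diff)
  ultimately obtain s where s: "p - [:x:] = [:- h x, 1:]\<^sup>2 * s"
    using single_root_dvd_square by blast
  have fz: "poly p (h z) - x = (h z - h x)\<^sup>2 * poly s (h z)" for z
    using arg_cong[OF s, of "\<lambda>q. poly q (h z)"] by simp
  have "bounded ((\<lambda>z. poly s (h z)) ` cball x 1)"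
    by (intro compact_imp_bounded compact_continuous_image continuous_intros
        continuous_on_subset[OF bi_lipschitz_continuous[OF assms(2)]]) auto
  then obtain M where M: "M > 0" "\<And>z. z \<in> cball x 1 \<Longrightarrow> cmod (poly s (h z)) \<le> M"
    by (auto simp: bounded_pos)
  define e where "e = min 1 (1 / (L\<^sup>2 * M))"
  have e: "e > 0" "e \<le> 1" "L\<^sup>2 * M * e \<le> 1"
    using L(1) M(1) by (auto simp: e_def min_def field_simps)
  show ?thesis
  proof (rule that[OF e(1)])
    fix z assume "z \<in> ball x e"
    then have z: "cmod (z - x) < e" by (simp add: dist_norm norm_minus_commute)
    then have "z \<in> cball x 1" using e by (simp add: dist_norm norm_minus_commute)
    have "cmod (poly p (h z) - x) = (cmod (h z - h x))\<^sup>2 * cmod (poly s (h z))"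
      by (simp add: fz norm_mult norm_power)
    also have "\<dots> \<le> (L * cmod (z - x))\<^sup>2 * M"
      using L M(1) M(2)[OF \<open>z \<in> cball x 1\<close>] by (intro mult_mono power_mono) auto
    also have "\<dots> = (L\<^sup>2 * M * cmod (z - x)) * cmod (z - x)"
      by (simp add: power2_eq_square)
    also have "\<dots> \<le> 1 * cmod (z - x)"
    proof (rule mult_right_mono)
      have "L\<^sup>2 * M * cmod (z - x) \<le> L\<^sup>2 * M * e" using z M(1) by (intro mult_left_mono) auto
      then show "L\<^sup>2 * M * cmod (z - x) \<le> 1" using e(3) by linarith
    qed simp
    finally show "poly p (h z) \<in> ball x e"
      using z by (simp add: dist_norm norm_minus_commute)
  qed
qed

section \<open>The escaping set and its frontier\<close>

theorem theorem4p3: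
  fixes p :: "complex poly" and d :: nat and L :: real
    and f g h :: "complex \<Rightarrow> complex"
  assumes "g = poly p" and "degree p = d" and "d \<ge> 2"
    and "bi_lipschitz L h"
    and "f = g \<circ> h"
  shows "escaping_set f \<noteq> {} \<and> open (escaping_set f) \<and> perfect_set (frontier (escaping_set f))"
proof -
  have deg: "degree p \<ge> 2" using assms by simp
  have f: "f z = poly p (h z)" for z using assms by simp
  obtain R where R: "R > 0" "\<And>z. cmod z > R \<Longrightarrow> cmod (f z) \<ge> 2 * cmod z"
    using poly_bi_lipschitz_expanding[OF deg assms(4)] unfolding f by blast
  have cont: "continuous_on UNIV f"
    unfolding f[abs_def] by (intro continuous_intros bi_lipschitz_continuous[OF assms(4)])
  have opn: "open (f ` U)" if "open U" for U
    using poly_open_image[of p "h ` U"] bi_lipschitz_open_image[OF assms(4) that] deg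
    by (simp add: f[abs_def] image_image)
  have eq: "escaping_set f = (\<Union>n. {z. cmod ((f ^^ n) z) > R})"
    by (rule escaping_set_eq_leave_disc[OF R])
  have "cmod ((f ^^ 0) (of_real (R + 1))) > R" using R(1) by (simp del: of_real_add)
  then have ne: "escaping_set f \<noteq> {}" unfolding eq by blast
  have op: "open (escaping_set f)" unfolding eq by (intro open_UN ballI open_leave_disc cont)
  have "\<not> x isolated_in frontier (escaping_set f)" for x
  proof
    assume "x isolated_in frontier (escaping_set f)"
    then obtain r where "r > 0" "x \<notin> escaping_set f" "ball x r - {x} \<subseteq> escaping_set f"
      using isolated_frontier_punctured_ball[OF op] by blast
    then have x: "- escaping_set f = {x}"
      using isolated_nonescaping_unique[OF R cont opn] by blast
    have iff: "w \<notin> escaping_set f \<longleftrightarrow> w = x" for w using x by blast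
    have "f z = x \<longleftrightarrow> z = x" for z
      using funpow_in_escaping_set_iff[of 1 f z] iff[of z] iff[of "f z"] by simp
    then obtain e where e: "e > 0" "\<And>z. z \<in> ball x e \<Longrightarrow> f z \<in> ball x e"
      using totally_invariant_point_stable[OF deg assms(4), of x] unfolding f by blast
    have "z = x" if z: "z \<in> ball x e" for z
    proof -
      have "(f ^^ n) z \<in> ball x e" for n by (induction n) (use z e in auto)
      then have "z \<notin> escaping_set f" by (rule not_escaping_if_bounded_orbit) auto
      then show ?thesis using iff by blast
    qed
    moreover have "x + of_real (e / 2) \<in> ball x e" using e(1) by (simp add: dist_norm)
    ultimately show False using e(1) by fastforce
  qed
  then show ?thesis using ne op by (simp add: perfect_set_def)
qed

end
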